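(* $f_6(4)=\dfrac{2}{3}$.
   Context: $\Delta(\cdot)$ denotes area in the Euclidean plane. For integers $n,m$ with $3\le m\le n-1$, define $$f_n(m)=\min_{P\in\mathcal{P}_n}\ \max_{Q\subset P,\ |Q|=m}\frac{\Delta(Q)}{\Delta(P)},$$ where $\mathcal{P}_n$ is the class of all convex $n$-gons in the plane and, for each $P$, the maximum is taken over all convex $m$-gons $Q$ contained in $P$ ($|Q|$ denotes the number of vertices of $Q$). *)

theory Defs
  imports "HOL-Analysis.Analysis"
begin

(* Polygons are closed regions. Extreme points count only genuine corners, so a convex n-gon has
   exactly n vertices; having at least three of them makes it non-degenerate. *)
definition convex_ngon :: "nat \<Rightarrow> (real ^ 2) set \<Rightarrow> bool" where
  "convex_ngon n P \<longleftrightarrow> 3 \<le> n \<and> polytope P \<and> card {v. v extreme_point_of P} = n"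

(* GREATEST and LEAST denote an attained maximum and minimum (not a supremum or infimum) and are
   unspecified if there is none. The vertices of Q need not be vertices of P. *)
definition max_area_ratio :: "nat \<Rightarrow> (real ^ 2) set \<Rightarrow> real" where
  "max_area_ratio m P =
     (GREATEST r. \<exists>Q. convex_ngon m Q \<and> Q \<subseteq> P \<and> r = measure lborel Q / measure lborel P)"

(* f_n(m); meaningful for 3 <= m <= n - 1. *)
definition minmax_area_ratio :: "nat \<Rightarrow> nat \<Rightarrow> real" where
  "minmax_area_ratio n m = (LEAST r. \<exists>P. convex_ngon n P \<and> r = max_area_ratio m P)"

end

theory Submission
  imports Defs
begin

text \<open>
  All areas are doubled and signed: \<open>orient a b c\<close> is twice the signed area of a triangle, and
  \<open>quad a b c d\<close>, the cross product of the diagonals, is twice the signed area of a quadrilateral.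

  \<^emph>\<open>Reduction to vertices.\<close> The function \<open>quad\<close> is affine in each of its four points.  A convex
  quadrilateral inside a polygon \<open>P\<close> can therefore be pushed, one point at a time, to a quadruple
  of vertices of \<open>P\<close> without decreasing \<open>quad\<close> (\<open>quad_hull_le\<close>).  The quadruple may end up
  degenerate or self-crossing, but if \<open>P\<close> has at least four vertices, then a quadruple of vertices
  that maximizes \<open>quad\<close> is a genuine convex quadrilateral (\<open>maximal_quad_ccw\<close>).  So the largest inscribed quadrilateral exists
  and its doubled area is the maximum of \<open>quad\<close> over the finitely many quadruples of vertices
  (\<open>max_area_ratio_eq\<close>).

  \<^emph>\<open>Lower bound.\<close> Let a hexagon have vertices \<open>v\<^sub>0, \<dots>, v\<^sub>5\<close> in cyclic order and let the ear \<open>T\<^sub>i\<close> be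
  the triangle \<open>v\<^sub>i\<^sub>-\<^sub>1 v\<^sub>i v\<^sub>i\<^sub>+\<^sub>1\<close>.  Deleting two non-neighbouring vertices \<open>v\<^sub>i\<close> and \<open>v\<^sub>j\<close> costs exactly the area of
  \<open>T\<^sub>i\<close> plus that of \<open>T\<^sub>j\<close>, and the claim is that the cheapest of these nine deletions costs at most
  a third of the hexagon (\<open>hexagon_cut\<close>).  Averaging over the ears does not suffice, since their total
  area can exceed that of the hexagon.  Instead, take the best pair, and coordinates along the
  diagonals of the remaining quadrilateral \<open>a b c d\<close>: \<open>a\<close>, \<open>b\<close>, \<open>c\<close>, \<open>d\<close> become \<open>(1,0)\<close>, \<open>(0,1)\<close>,
  \<open>(-s,0)\<close>, \<open>(0,-t)\<close>, with doubled area \<open>(1 + s)(1 + t)\<close>.  That no other deletion is cheaper gives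
  polynomial inequalities between the coordinates of the two deleted points.  Up to rotation the deleted
  vertices are opposite (\<open>opposite_cut\<close>) or two steps apart (\<open>distance_two_cut\<close>), and in both cases
  these inequalities bound the loss by \<open>(1 + s)(1 + t) / 2\<close>.

  \<^emph>\<open>Upper bound.\<close> For an affine image of the regular hexagon with doubled area \<open>6\<close>, the two diagonals of a
  quadruple of vertices lie in the doubled hexagon, where the cross product is at most \<open>4\<close>
  (\<open>extremal_hexagon\<close>).
\<close>

section \<open>Orientation of triples\<close>

definition cross :: "real ^ 2 \<Rightarrow> real ^ 2 \<Rightarrow> real" where
  "cross u v = u $ 1 * v $ 2 - u $ 2 * v $ 1"

definition orient :: "real ^ 2 \<Rightarrow> real ^ 2 \<Rightarrow> real ^ 2 \<Rightarrow> real" where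
  "orient a b c = cross (b - a) (c - a)"

lemmas orient_coords = orient_def cross_def vector_minus_component

lemma orient_rotate: "orient b c a = orient a b c"
  by (simp add: orient_coords algebra_simps)

lemma orient_swap: "orient b a c = - orient a b c"
  by (simp add: orient_coords algebra_simps)

lemma orient_degenerate [simp]: "orient a a b = 0" "orient a b a = 0" "orient a b b = 0"
  by (simp_all add: orient_coords)

lemma orient_affine:
  "u + v = 1 \<Longrightarrow> orient a b (u *\<^sub>R x + v *\<^sub>R y) = u * orient a b x + v * orient a b y"
proof -
  assume "u + v = 1"
  then have "v = 1 - u" by simp
  then show ?thesis by (simp add: orient_coords) (simp add: algebra_simps)
qed

lemma convex_orient_nonneg: "convex {z. 0 \<le> orient a b z}"
  by (simp add: convex_def orient_affine)

lemma orient_hull_nonneg: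
  assumes "\<And>k. k \<in> S \<Longrightarrow> 0 \<le> orient a b k" "z \<in> convex hull S"
  shows "0 \<le> orient a b z"
proof -
  have "convex hull S \<subseteq> {z. 0 \<le> orient a b z}"
    by (rule hull_minimal) (use assms(1) convex_orient_nonneg in auto)
  then show ?thesis using assms(2) by blast
qed

text \<open>
  Cramer's rule, with the denominators cleared: the barycentric coordinates of a point are the
  signed areas that it spans with the three sides.
\<close>

lemma barycentric:
  "orient a b c *\<^sub>R z = orient b c z *\<^sub>R a + orient c a z *\<^sub>R b + orient a b z *\<^sub>R c"
  by (simp add: vec_eq_iff forall_2 orient_coords) (simp add: algebra_simps)

lemma orient_sum: "orient b c z + orient c a z + orient a b z = orient a b c"
  by (simp add: orient_coords algebra_simps)

lemma in_triangle:
  assumes "0 < orient a b c" "0 \<le> orient b c z" "0 \<le> orient c a z" "0 \<le> orient a b z"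
  shows "z \<in> convex hull {a, b, c}"
proof -
  let ?D = "orient a b c"
  have "z = (1 / ?D) *\<^sub>R (?D *\<^sub>R z)" using assms(1) by simp
  also have "\<dots> = (orient b c z / ?D) *\<^sub>R a + (orient c a z / ?D) *\<^sub>R b + (orient a b z / ?D) *\<^sub>R c"
    by (subst barycentric) (simp add: scaleR_add_right)
  finally have "z = (orient b c z / ?D) *\<^sub>R a + (orient c a z / ?D) *\<^sub>R b + (orient a b z / ?D) *\<^sub>R c" .
  moreover have "orient b c z / ?D + orient c a z / ?D + orient a b z / ?D = 1"
    using orient_sum[of b c z a] assms(1) by (simp add: add_divide_distrib[symmetric])
  ultimately show ?thesis using assms unfolding convex_hull_3
    by (smt (verit, best) divide_nonneg_pos mem_Collect_eq)
qed

section \<open>Area of a convex polygon\<close>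

text \<open>
  Every triple of the list, in list order, turns left.  For points in convex position this says
  that the list runs once around their hull counterclockwise; asking for all triples rather than for
  consecutive ones excludes lists that wind around several times, and makes sublists inherit the property.
\<close>

fun ccw :: "(real ^ 2) list \<Rightarrow> bool" where
  "ccw [] = True"
| "ccw (x # xs) = (sorted_wrt (\<lambda>y z. 0 < orient x y z) xs \<and> ccw xs)"

text \<open>
  Twice the area of the polygon \<open>x # ys\<close>, triangulated from its vertex \<open>x\<close>.
\<close>

fun fan :: "real ^ 2 \<Rightarrow> (real ^ 2) list \<Rightarrow> real" where
  "fan x (y # z # zs) = orient x y z + fan x (z # zs)"
| "fan x _ = 0"

text \<open>
  The point \<open>b\<close> lies beyond the chord \<open>ac\<close> of \<open>K\<close> and, by the last two hypotheses, sees \<open>K\<close> within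
  the angle \<open>abc\<close>.  So every segment from \<open>b\<close> into \<open>K\<close> leaves the triangle through the side \<open>ac\<close>,
  and convexity of \<open>K\<close> absorbs the rest of it.
\<close>

lemma ear:
  assumes K: "convex K" "a \<in> K" "c \<in> K" and b: "orient a c b < 0"
    and ac: "\<And>k. k \<in> K \<Longrightarrow> 0 \<le> orient a c k"
    and ab: "\<And>k. k \<in> K \<Longrightarrow> 0 \<le> orient a b k"
    and bc: "\<And>k. k \<in> K \<Longrightarrow> 0 \<le> orient b c k"
  shows "convex hull (insert b K) = K \<union> convex hull {a, b, c}"
proof
  have D: "0 < orient a b c" using b by (simp add: orient_coords algebra_simps)
  show "K \<union> convex hull {a, b, c} \<subseteq> convex hull (insert b K)"
    using K by (intro Un_least hull_mono) (auto intro: hull_inc)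
  show "convex hull (insert b K) \<subseteq> K \<union> convex hull {a, b, c}"
  proof
    fix z assume "z \<in> convex hull (insert b K)"
    moreover have "convex hull K = K" "K \<noteq> {}" using K by (auto simp: convex_hull_eq)
    ultimately obtain u v k where uv: "0 \<le> u" "0 \<le> v" "u + v = 1" "k \<in> K" and z: "z = u *\<^sub>R b + v *\<^sub>R k"
      by (auto simp: convex_hull_insert)
    have ab': "0 \<le> orient a b z" using uv ab by (simp add: z orient_affine)
    have bc': "0 \<le> orient b c z" using uv bc by (simp add: z orient_affine)
    show "z \<in> K \<union> convex hull {a, b, c}"
    proof (cases "orient a c z \<le> 0")
      case True
      then have "0 \<le> orient c a z" by (simp add: orient_swap[of c a])
      then show ?thesis using in_triangle[OF D bc' _ ab'] by blast
    next
      case False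
      define Dk Db where "Dk = orient a c k" and "Db = orient a c b"
      have Db: "Db < 0" using b by (simp add: Db_def)
      have "0 < u * Db + v * Dk" using False uv by (simp add: z orient_affine Dk_def Db_def)
      moreover have "u * Db \<le> 0" using uv Db by (simp add: mult_nonneg_nonpos)
      ultimately have "0 < v * Dk" by linarith
      then have Dk: "0 < Dk" using uv by (simp add: zero_less_mult_iff)
      \<comment> \<open>\<open>w\<close> is the point where the segment from \<open>b\<close> to \<open>k\<close> meets the line \<open>ac\<close>, and \<open>z\<close> lies between \<open>w\<close> and \<open>k\<close>.\<close>
      define m where "m = Dk / (Dk - Db)"
      have m: "0 < m" "m \<le> 1" using Dk Db by (auto simp: m_def)
      have "u * (Dk - Db) < Dk"
      proof -
        have "v = 1 - u" using uv by simp
        show ?thesis using \<open>0 < u * Db + v * Dk\<close> unfolding \<open>v = 1 - u\<close> by (simp add: algebra_simps)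
      qed
      then have um: "u < m" using Dk Db by (simp add: m_def field_simps)
      define w where "w = m *\<^sub>R b + (1 - m) *\<^sub>R k"
      have w0: "orient a c w = 0"
        using Dk Db by (simp add: w_def orient_affine Dk_def[symmetric] Db_def[symmetric])
          (simp add: m_def field_simps)
      have "0 \<le> orient a b w" "0 \<le> orient b c w" using m ab bc uv
        by (auto simp: w_def orient_affine)
      moreover have ca: "orient c a w = 0" using w0 by (simp add: orient_swap[of c a])
      moreover have "orient b c w + orient a b w = orient a b c"
        using orient_sum[of b c w a] ca by simp
      moreover have "w = (orient b c w / orient a b c) *\<^sub>R a + (orient a b w / orient a b c) *\<^sub>R c"
      proof -
        have "w = (1 / orient a b c) *\<^sub>R (orient a b c *\<^sub>R w)" using D by simp
        also have "\<dots> = (orient b c w / orient a b c) *\<^sub>R a + (orient a b w / orient a b c) *\<^sub>R c"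
          by (subst barycentric) (simp add: ca scaleR_add_right)
        finally show ?thesis .
      qed
      ultimately have "w \<in> K"
        using convexD[OF K(1-3), of "orient b c w / orient a b c" "orient a b w / orient a b c"] D
        by (simp add: add_divide_distrib[symmetric])
      moreover have "z = (u / m) *\<^sub>R w + (1 - u / m) *\<^sub>R k"
      proof -
        have "(u / m) *\<^sub>R w = u *\<^sub>R b + (u / m - u) *\<^sub>R k"
          using m by (simp add: w_def scaleR_add_right algebra_simps)
        moreover have "v = 1 - u" using uv by simp
        ultimately show ?thesis by (simp add: z scaleR_left_diff_distrib)
      qed
      moreover have "0 \<le> u / m" "u / m \<le> 1" using uv m um by auto
      ultimately have "z \<in> K" using convexD[OF K(1) _ uv(4), of w "u / m" "1 - u / m"] by simp
      then show ?thesis by simp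
    qed
  qed
qed

lemma triangle_area: "measure lborel (convex hull {a, b, c}) = \<bar>orient a b c\<bar> / 2"
  by (subst content_triangle) (simp add: orient_coords abs_minus_commute mult.commute)

lemma line_null:
  assumes "a \<noteq> c" shows "negligible {z. orient a c z = 0}"
proof -
  define n :: "real ^ 2" where "n = vector [a $ 2 - c $ 2, c $ 1 - a $ 1]"
  have "n \<noteq> 0" using assms by (auto simp: n_def vec_eq_iff forall_2)
  moreover have "{z. orient a c z = 0} = {z. n \<bullet> z = n \<bullet> a}"
    by (auto simp: n_def inner_vec_def sum_2 orient_coords algebra_simps)
  ultimately show ?thesis
    using negligible_hyperplane[of n "n \<bullet> a"] by simp
qed

text \<open>
  Cutting off the second vertex of the list removes the first triangle of the fan and leaves a
  shorter counterclockwise list with the same apex.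
\<close>

lemma ccw_fan_area:
  assumes "ccw (x # ys)"
  shows "measure lborel (convex hull (set (x # ys))) = fan x ys / 2"
  using assms
proof (induction x ys rule: fan.induct)
  case (1 x y z zs)
  let ?K = "convex hull (set (x # z # zs))"
  have xyz: "0 < orient x y z" using 1 by simp
  have "measure lborel ?K = fan x (z # zs) / 2" using 1 by (intro "1.IH") auto
  have eq: "convex hull (set (x # y # z # zs)) = ?K \<union> convex hull {x, y, z}"
  proof -
    have "set (x # y # z # zs) = insert y (set (x # z # zs))" by auto
    then have "convex hull (set (x # y # z # zs)) = convex hull (insert y ?K)"
      using hull_insert by metis
    also have "\<dots> = ?K \<union> convex hull {x, y, z}"
    proof (rule ear)
      show "orient x z y < 0" using xyz by (simp add: orient_coords algebra_simps)
      show "0 \<le> orient x z k" if "k \<in> ?K" for k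
        using 1 by (intro orient_hull_nonneg[OF _ that]) (auto intro: less_imp_le)
      show "0 \<le> orient x y k" if "k \<in> ?K" for k
        using 1 by (intro orient_hull_nonneg[OF _ that]) (auto intro: less_imp_le)
      show "0 \<le> orient y z k" if "k \<in> ?K" for k
        using 1 by (intro orient_hull_nonneg[OF _ that]) (auto intro: less_imp_le simp: orient_rotate)
    qed (auto intro: hull_inc)
    finally show ?thesis .
  qed
  have ac: "0 \<le> orient x z k" if "k \<in> ?K" for k
    using 1 by (intro orient_hull_nonneg[OF _ that]) (auto intro: less_imp_le)
  have ca: "0 \<le> orient z x k" if "k \<in> convex hull {x, y, z}" for k
    using 1 by (intro orient_hull_nonneg[OF _ that]) (auto intro: less_imp_le simp: orient_rotate)
  have "?K \<inter> convex hull {x, y, z} \<subseteq> {k. orient x z k = 0}"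
    using ac ca by (force simp: orient_swap[of z x])
  moreover have "x \<noteq> z" using xyz by auto
  ultimately have "negligible (?K \<inter> convex hull {x, y, z})"
    using line_null negligible_subset by blast
  then have 0: "measure lebesgue (?K \<inter> convex hull {x, y, z}) = 0"
    by (rule negligible_imp_measure0)
  have compact: "compact ?K" "compact (convex hull {x, y, z})"
    by (simp_all only: compact_convex_hull finite_imp_compact finite_set finite.intros)
  then have meas: "?K \<in> lmeasurable" "convex hull {x, y, z} \<in> lmeasurable"
    by (auto intro: lmeasurable_compact)
  have bor: "?K \<in> sets borel" "convex hull {x, y, z} \<in> sets borel"
    using compact by (auto intro: borel_compact)
  have "measure lebesgue (?K \<union> convex hull {x, y, z}) = measure lebesgue ?K + measure lebesgue (convex hull {x, y, z})"
    using measure_Un3[OF meas] 0 by simp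
  then have "measure lborel (?K \<union> convex hull {x, y, z}) = measure lborel ?K + measure lborel (convex hull {x, y, z})"
    using bor by (simp del: set_simps)
  then show ?case using eq \<open>measure lborel ?K = _\<close> xyz triangle_area[of x y z] by simp
next
  case ("2_1" x)
  show ?case using triangle_area[of x x x] by simp
next
  case ("2_2" x y)
  show ?case using triangle_area[of x x y] by simp
qed


section \<open>Cyclic order of the vertices\<close>

definition convex_independent :: "(real ^ 2) set \<Rightarrow> bool" where
  "convex_independent S \<longleftrightarrow> (\<forall>a\<in>S. a \<notin> convex hull (S - {a}))"

lemma convex_independent_subset: "convex_independent S \<Longrightarrow> T \<subseteq> S \<Longrightarrow> convex_independent T"
  unfolding convex_independent_def using hull_mono[of "T - {_}" "S - {_}" convex] by blast

text \<open>
  Of three points on a line one lies between the other two.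
\<close>

lemma convex_independent_not_collinear:
  assumes S: "convex_independent S" and abc: "a \<in> S" "b \<in> S" "c \<in> S" "distinct [a, b, c]"
  shows "orient a b c \<noteq> 0"
proof
  assume 0: "orient a b c = 0"
  have "\<exists>t. c - a = t *\<^sub>R (b - a)"
  proof (cases "b $ 1 = a $ 1")
    case True
    then have "b $ 2 - a $ 2 \<noteq> 0" using abc by (auto simp: vec_eq_iff forall_2)
    moreover from this have "c $ 1 = a $ 1" using 0 True by (simp add: orient_coords)
    ultimately show ?thesis using True
      by (intro exI[of _ "(c $ 2 - a $ 2) / (b $ 2 - a $ 2)"]) (simp add: vec_eq_iff forall_2)
  next
    case False
    then have "b $ 1 - a $ 1 \<noteq> 0" by simp
    moreover have "(b $ 1 - a $ 1) * (c $ 2 - a $ 2) = (b $ 2 - a $ 2) * (c $ 1 - a $ 1)"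
      using 0 by (simp add: orient_coords)
    ultimately show ?thesis
      by (intro exI[of _ "(c $ 1 - a $ 1) / (b $ 1 - a $ 1)"])
         (simp add: vec_eq_iff forall_2 nonzero_eq_divide_eq mult.commute)
  qed
  then obtain t where t: "c - a = t *\<^sub>R (b - a)" by blast
  have "collinear {a, b, c}"
    unfolding collinear_def
    by (rule exI[of _ "b - a"])
       (use t in \<open>auto intro: exI[of _ 0] exI[of _ 1] exI[of _ "-1"] exI[of _ t] exI[of _ "-t"]
          exI[of _ "1-t"] exI[of _ "t-1"] simp: algebra_simps\<close>)
  then have "a \<in> convex hull {b, c} \<or> b \<in> convex hull {c, a} \<or> c \<in> convex hull {a, b}"
    by (simp add: collinear_between_cases between_mem_convex_hull)
  moreover have "{b, c} \<subseteq> S - {a}" "{c, a} \<subseteq> S - {b}" "{a, b} \<subseteq> S - {c}" using abc by auto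
  ultimately show False using S abc hull_mono[of _ _ convex] unfolding convex_independent_def by blast
qed

text \<open>
  Seen from \<open>v\<close>, let \<open>y\<close> come between \<open>x\<close> and \<open>z\<close>.  If the turn at \<open>y\<close> were not to the left, then \<open>y\<close>
  would lie inside the triangle \<open>vxz\<close>.
\<close>

lemma ccw_of_fan_sorted:
  assumes "convex_independent S" "v \<in> S" "set xs \<subseteq> S" "sorted_wrt (\<lambda>y z. 0 < orient v y z) xs"
  shows "ccw xs"
  using assms(3,4)
proof (induction xs)
  case (Cons x xs)
  have "sorted_wrt (\<lambda>y z. 0 < orient x y z) xs"
  proof (rule sorted_wrt_mono_rel)
    show "sorted_wrt (\<lambda>y z. 0 < orient v y z) xs" using Cons by simp
    fix y z assume yz: "y \<in> set xs" "z \<in> set xs" "0 < orient v y z"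
    have xyz: "0 < orient v x y" "0 < orient v x z" using Cons yz by auto
    then have ne: "v \<noteq> y" "x \<noteq> y" "z \<noteq> y" using yz by auto
    show "0 < orient x y z"
    proof (rule ccontr)
      assume "\<not> 0 < orient x y z"
      then have "0 \<le> orient x z y" by (simp add: orient_coords algebra_simps)
      moreover have "0 \<le> orient z v y" using yz orient_rotate[of v z y] orient_rotate[of z y v]
        by (metis less_imp_le orient_rotate)
      ultimately have "y \<in> convex hull {v, x, z}" using xyz by (intro in_triangle) auto
      moreover have "{v, x, z} \<subseteq> S - {y}" using assms(2) Cons yz ne by auto
      moreover have "y \<in> S" using Cons yz by auto
      ultimately show False
        using assms(1) hull_mono[of _ _ convex] unfolding convex_independent_def by blast
    qed
  qed
  then show ?case using Cons by simp
qed simp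

lemma ex_sorted_by_key:
  fixes g :: "'a \<Rightarrow> real"
  assumes "finite T" "inj_on g T"
  obtains xs where "set xs = T" "distinct xs" "sorted_wrt (\<lambda>y z. g y < g z) xs"
proof -
  let ?xs = "map (inv_into T g) (sorted_list_of_set (g ` T))"
  have g: "g (inv_into T g r) = r" "inv_into T g r \<in> T" if "r \<in> g ` T" for r
    using that by (auto simp: f_inv_into_f inv_into_into)
  have "set ?xs = T" using assms by (simp add: image_image inv_into_f_f)
  moreover have "sorted_wrt (\<lambda>y z. g y < g z) ?xs"
    unfolding sorted_wrt_map
    by (rule sorted_wrt_mono_rel[OF _ strict_sorted_list_of_set]) (use g assms in auto)
  moreover have "distinct ?xs"
    using assms by (auto simp: distinct_map intro: inj_on_inv_into)
  ultimately show ?thesis using that by blast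
qed

text \<open>
  A line separates the vertex \<open>v\<close> from all the others.  In coordinates adapted to its normal \<open>n\<close>, the
  others lie in an open half-plane as seen from \<open>v\<close>, so sorting them by angle amounts to sorting by
  the slope \<open>g\<close>.
\<close>

lemma convex_independent_ccw:
  assumes S: "finite S" "convex_independent S"
  obtains xs where "set xs = S" "distinct xs" "ccw xs"
proof (cases "S = {}")
  case True
  then show ?thesis using that[of "[]"] by simp
next
  case False
  then obtain v where v: "v \<in> S" by blast
  let ?T = "S - {v}"
  have "v \<notin> convex hull ?T" using S v by (simp add: convex_independent_def)
  moreover have "closed (convex hull ?T)"
    using S by (intro compact_imp_closed compact_convex_hull finite_imp_compact) simp
  ultimately obtain n r where n: "n \<bullet> v < r" "\<And>y. y \<in> convex hull ?T \<Longrightarrow> r < n \<bullet> y"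
    using separating_hyperplane_closed_point[of "convex hull ?T" v] by auto
  have pos: "0 < n \<bullet> (y - v)" if "y \<in> ?T" for y
  proof -
    have "r < n \<bullet> y" using n(2) hull_inc[of y ?T convex] that by blast
    then show ?thesis using n(1) by (simp add: inner_diff_right)
  qed
  define g where "g y = cross n (y - v) / (n \<bullet> (y - v))" for y
  have id: "(n \<bullet> n) * orient v y z =
      (n \<bullet> (y - v)) * cross n (z - v) - cross n (y - v) * (n \<bullet> (z - v))" for y z
    by (simp add: orient_coords inner_vec_def sum_2) (simp add: algebra_simps)
  have gdiff: "(n \<bullet> n) * orient v y z = (n \<bullet> (y - v)) * (n \<bullet> (z - v)) * (g z - g y)"
    if "y \<in> ?T" "z \<in> ?T" for y z
    unfolding id g_def using pos[OF that(1)] pos[OF that(2)] by (simp add: field_simps)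
  have "inj_on g ?T"
  proof (rule inj_onI, rule ccontr)
    fix y z assume yz: "y \<in> ?T" "z \<in> ?T" "g y = g z" "y \<noteq> z"
    have "n \<noteq> 0" using pos[OF yz(1)] by auto
    then have "orient v y z = 0" using gdiff[OF yz(1,2)] yz by simp
    then show False using convex_independent_not_collinear[OF S(2) v, of y z] yz by auto
  qed
  then obtain xs where xs: "set xs = ?T" "distinct xs" "sorted_wrt (\<lambda>y z. g y < g z) xs"
    using ex_sorted_by_key[of ?T g] S by auto
  have sorted: "sorted_wrt (\<lambda>y z. 0 < orient v y z) xs"
  proof (rule sorted_wrt_mono_rel[OF _ xs(3)])
    fix y z assume "y \<in> set xs" "z \<in> set xs" "g y < g z"
    then have yz: "y \<in> ?T" "z \<in> ?T" "0 < g z - g y" using xs by auto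
    then have "0 < (n \<bullet> n) * orient v y z" using pos by (simp add: gdiff)
    then show "0 < orient v y z" using inner_ge_zero[of n]
      by (metis mult_nonneg_nonpos not_less)
  qed
  then have "ccw (v # xs)" using ccw_of_fan_sorted[OF S(2) v, of xs] xs by auto
  then show ?thesis using that[of "v # xs"] xs v by auto
qed

section \<open>Largest quadrilaterals are spanned by vertices\<close>

text \<open>
  Twice the signed area of the closed polygon \<open>abcd\<close>.  It is meaningful, and affine in each
  point, for self-crossing and degenerate quadruples as well.
\<close>

definition quad :: "real ^ 2 \<Rightarrow> real ^ 2 \<Rightarrow> real ^ 2 \<Rightarrow> real ^ 2 \<Rightarrow> real" where
  "quad a b c d = cross (c - a) (d - b)"

lemma quad_split: "quad a b c d = orient a b c + orient a c d"
  by (simp add: quad_def orient_coords algebra_simps)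

lemma quad_rotate: "quad b c d a = quad a b c d"
  by (simp add: quad_def cross_def algebra_simps)

lemma convex_quad_le: "convex {z. quad z b c d \<le> M}"
proof -
  have "quad z b c d = orient b d z + orient b c d" for z
    by (simp add: quad_def orient_coords algebra_simps)
  moreover have "u * orient b d x + v * orient b d y \<le> M - orient b c d"
    if "orient b d x \<le> M - orient b c d" "orient b d y \<le> M - orient b c d" "0 \<le> u" "0 \<le> v" "u + v = 1"
    for u v x y using that by (rule convex_bound_le)
  ultimately show ?thesis by (simp add: convex_def orient_affine le_diff_eq)
qed

text \<open>
  An affine function on a hull is bounded by its values at the generators.  This is used for one
  argument at a time, and \<open>quad_rotate\<close> brings each of the four arguments to the front.
\<close>

lemma quad_hull_le:
  assumes "\<And>a b c d. a \<in> S \<Longrightarrow> b \<in> S \<Longrightarrow> c \<in> S \<Longrightarrow> d \<in> S \<Longrightarrow> quad a b c d \<le> M"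
    and "a \<in> convex hull S" "b \<in> convex hull S" "c \<in> convex hull S" "d \<in> convex hull S"
  shows "quad a b c d \<le> M"
proof -
  have step: "quad a b c d \<le> M" if "\<And>a. a \<in> S \<Longrightarrow> quad a b c d \<le> M" "a \<in> convex hull S" for a b c d
  proof -
    have "convex hull S \<subseteq> {z. quad z b c d \<le> M}"
      by (rule hull_minimal) (use that(1) convex_quad_le in auto)
    then show ?thesis using that(2) by blast
  qed
  have 1: "quad a b c d \<le> M" if "a \<in> convex hull S" "b \<in> S" "c \<in> S" "d \<in> S" for a b c d
    using that assms(1) by (rule_tac step) auto
  have 2: "quad b c d a \<le> M" if "a \<in> convex hull S" "b \<in> convex hull S" "c \<in> S" "d \<in> S" for a b c d
    using that 1[of a] by (rule_tac step) (simp_all add: quad_rotate[of _ c d a])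
  have 3: "quad c d a b \<le> M"
    if "a \<in> convex hull S" "b \<in> convex hull S" "c \<in> convex hull S" "d \<in> S" for a b c d
    using that 2[of a b] by (rule_tac step) (simp_all add: quad_rotate[of _ d a b])
  have "quad d a b c \<le> M"
    using assms(2-) 3[of a b c] by (rule_tac step) (simp_all add: quad_rotate[of _ a b c])
  then show ?thesis by (simp add: quad_rotate[of d a b c, symmetric] quad_rotate)
qed

lemma quad_area:
  "ccw [a, b, c, d] \<Longrightarrow> measure lborel (convex hull {a, b, c, d}) = quad a b c d / 2"
  using ccw_fan_area[of a "[b, c, d]"] by (simp add: quad_split)

text \<open>
  A triangle \<open>pqr\<close> of points of \<open>V\<close> is never maximal: some fourth point lies beyond one of its sides, and
  inserting it there increases \<open>quad\<close>.  Now each of the four triangles in \<open>abcd\<close> is the difference between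
  \<open>quad a b c d\<close> and the complementary triangle, so it is positive.
\<close>

lemma maximal_quad_ccw:
  assumes V: "finite V" "convex_independent V" "4 \<le> card V"
    and w: "a \<in> V" "b \<in> V" "c \<in> V" "d \<in> V"
    and max: "\<And>p q r s. p \<in> V \<Longrightarrow> q \<in> V \<Longrightarrow> r \<in> V \<Longrightarrow> s \<in> V \<Longrightarrow> quad p q r s \<le> quad a b c d"
  shows "ccw [a, b, c, d]"
proof -
  define M where "M = quad a b c d"
  have pos: "0 < M"
  proof -
    obtain xs where xs: "set xs = V" "distinct xs" "ccw xs" using convex_independent_ccw[OF V(1,2)] .
    then have "4 \<le> length xs" using V by (metis distinct_card)
    then obtain p q r ys where ys: "xs = p # q # r # ys"
      by (auto simp: numeral_eq_Suc Suc_le_length_iff)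
    then have "0 < orient p q r" using xs by simp
    also have "\<dots> \<le> M" using max[of p q r r] xs ys by (auto simp: M_def quad_split)
    finally show ?thesis .
  qed
  have tri: "orient p q r < M" if pqr: "p \<in> V" "q \<in> V" "r \<in> V" for p q r
  proof (cases "0 < orient p q r")
    case True
    have "card {p, q, r} < card V" using V(3) card_length[of "[p, q, r]"] by simp
    then obtain v where v: "v \<in> V" "v \<notin> {p, q, r}"
      by (metis card_mono finite.emptyI finite.insertI not_less subsetI)
    have "v \<notin> convex hull {p, q, r}"
      using V(2) v pqr hull_mono[of "{p, q, r}" "V - {v}" convex] unfolding convex_independent_def by blast
    then have "orient q r v < 0 \<or> orient r p v < 0 \<or> orient p q v < 0"
      using in_triangle[OF True, of v] by (meson not_less)
    moreover have "quad p v q r = orient p q r - orient p q v" "quad p q v r = orient p q r - orient q r v"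
      "quad p q r v = orient p q r - orient r p v"
      by (simp_all add: quad_def orient_coords algebra_simps)
    moreover have "quad p v q r \<le> M" "quad p q v r \<le> M" "quad p q r v \<le> M"
      using max v pqr by (auto simp: M_def)
    ultimately show ?thesis by linarith
  qed (use pos in simp)
  have "orient a b c + orient a c d = M" "orient b c d + orient b d a = M"
    by (simp_all add: M_def quad_split[symmetric]) (rule quad_rotate)
  then have "0 < orient a b c" "0 < orient a c d" "0 < orient b c d" "0 < orient b d a"
    using tri w by (smt (verit))+
  then show ?thesis by (simp add: orient_rotate)
qed

lemma ngon_vertices:
  assumes "convex_ngon n P"
  defines "V \<equiv> {v. v extreme_point_of P}"
  shows "finite V" "card V = n" "convex_independent V" "P = convex hull V" "3 \<le> n"
proof -
  have P: "polytope P" "card V = n" "3 \<le> n" using assms by (auto simp: convex_ngon_def)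
  then show fin: "finite V" "card V = n" "3 \<le> n" by (auto intro: card_ge_0_finite)
  show hull: "P = convex hull V" unfolding V_def
    using P by (intro Krein_Milman_Minkowski) (auto intro: polytope_imp_compact polytope_imp_convex)
  have "v \<notin> convex hull (V - {v})" if "v \<in> V" for v
  proof
    assume v: "v \<in> convex hull (V - {v})"
    have "v extreme_point_of P" using that by (simp add: V_def)
    then have "v extreme_point_of convex hull V" by (subst hull[symmetric])
    moreover have "convex hull V = convex hull (V - {v})"
      using hull_redundant[OF v] insert_Diff[OF that] by simp
    ultimately show False using extreme_point_of_convex_hull[of v "V - {v}"] by auto
  qed
  then show "convex_independent V" by (simp add: convex_independent_def)
qed

lemma ngon_hull:
  assumes "finite S" "convex_independent S" "3 \<le> card S"
  shows "convex_ngon (card S) (convex hull S)"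
proof -
  have "{v. v extreme_point_of convex hull S} = S"
    using assms extreme_point_of_convex_hull_convex_independent[of S]
    by (auto simp: convex_independent_def finite_imp_compact)
  then show ?thesis using assms by (auto simp: convex_ngon_def polytope_def)
qed

text \<open>
  The maximum is attained at the hull of a maximizing quadruple of vertices.  It cannot be exceeded,
  because the corners of any inscribed quadrilateral, in counterclockwise order, form a quadruple in
  the hull of the vertices.
\<close>

lemma max_area_ratio_eq:
  assumes P: "convex_ngon n P" "4 \<le> n"
  defines "V \<equiv> {v. v extreme_point_of P}"
  defines "M \<equiv> Max ((\<lambda>(p, q, r, s). quad p q r s) ` (V \<times> V \<times> V \<times> V))"
  shows "max_area_ratio 4 P = M / 2 / measure lborel P"
proof -
  note V = ngon_vertices[OF P(1), folded V_def]
  let ?F = "(\<lambda>(p, q, r, s). quad p q r s) ` (V \<times> V \<times> V \<times> V)"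
  have fin: "finite ?F" using V by simp
  have "V \<noteq> {}" using V by auto
  then have "M \<in> ?F" unfolding M_def by (intro Max_in[OF fin]) auto
  then obtain a b c d where inV: "a \<in> V" "b \<in> V" "c \<in> V" "d \<in> V" and M: "M = quad a b c d" by auto
  have max: "quad p q r s \<le> quad a b c d" if "p \<in> V" "q \<in> V" "r \<in> V" "s \<in> V" for p q r s
    unfolding M[symmetric] M_def using that by (intro Max_ge[OF fin]) force
  have ccw: "ccw [a, b, c, d]" using maximal_quad_ccw[OF V(1,3) _ inV max] V P by simp
  have distinct: "card {a, b, c, d} = 4" using ccw by (auto simp: card_insert_if)
  let ?Q = "convex hull {a, b, c, d}"
  have "convex_ngon 4 ?Q"
    using ngon_hull[of "{a, b, c, d}"] distinct convex_independent_subset[OF V(3)] inV by simp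
  moreover have "?Q \<subseteq> P" using V(4) inV by (metis hull_mono insert_subset empty_subsetI)
  moreover have "measure lborel ?Q = M / 2" unfolding M using ccw by (rule quad_area)
  ultimately have ex: "\<exists>Q. convex_ngon 4 Q \<and> Q \<subseteq> P \<and> M / 2 / measure lborel P = measure lborel Q / measure lborel P"
    by metis
  have "measure lborel Q \<le> M / 2" if Q: "convex_ngon 4 Q" "Q \<subseteq> P" for Q
  proof -
    note W = ngon_vertices[OF Q(1)]
    obtain xs where xs: "set xs = {v. v extreme_point_of Q}" "distinct xs" "ccw xs"
      using convex_independent_ccw[OF W(1,3)] .
    then have "length xs = 4" using W by (metis distinct_card)
    then obtain p q r s where pqrs: "xs = [p, q, r, s]"
      by (auto simp: numeral_eq_Suc length_Suc_conv)
    then have hull: "Q = convex hull {p, q, r, s}" using W(4) xs by simp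
    then have "{p, q, r, s} \<subseteq> convex hull V" using Q(2) V(4) hull_subset[of "{p, q, r, s}" convex] by auto
    then have "quad p q r s \<le> M" unfolding M by (intro quad_hull_le[of V, OF max]) auto
    then show ?thesis using quad_area xs pqrs hull by simp
  qed
  then have le: "measure lborel Q / measure lborel P \<le> M / 2 / measure lborel P"
    if "convex_ngon 4 Q" "Q \<subseteq> P" for Q
    using that by (intro divide_right_mono) auto
  show ?thesis
    unfolding max_area_ratio_def by (rule Greatest_equality, rule ex) (use le in blast)
qed

section \<open>Affine coordinates along the diagonals\<close>

definition pt :: "real ^ 2 \<Rightarrow> real ^ 2 \<Rightarrow> real ^ 2 \<Rightarrow> real \<Rightarrow> real \<Rightarrow> real ^ 2" where
  "pt z u v x y = z + x *\<^sub>R u + y *\<^sub>R v"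

lemma orient_pt: "orient (pt z u v a1 a2) (pt z u v b1 b2) (pt z u v c1 c2) =
    ((b1 - a1) * (c2 - a2) - (b2 - a2) * (c1 - a1)) * cross u v"
  by (simp add: pt_def orient_coords) (simp add: algebra_simps)

lemma quad_pt: "quad (pt z u v a1 a2) (pt z u v b1 b2) (pt z u v c1 c2) (pt z u v d1 d2) =
    ((c1 - a1) * (d2 - b2) - (c2 - a2) * (d1 - b1)) * cross u v"
  by (simp add: pt_def quad_def cross_def) (simp add: algebra_simps)

text \<open>
  Cramer's rule for the basis \<open>u\<close>, \<open>v\<close>.
\<close>

lemma ex_pt:
  assumes "cross u v \<noteq> 0" obtains x y where "w = pt z u v x y"
proof
  have "cross u v *\<^sub>R (w - z) = cross (w - z) v *\<^sub>R u + cross u (w - z) *\<^sub>R v"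
    by (simp add: vec_eq_iff forall_2 cross_def) (simp add: algebra_simps)
  then have "(1 / cross u v) *\<^sub>R (cross u v *\<^sub>R (w - z)) =
      (1 / cross u v) *\<^sub>R (cross (w - z) v *\<^sub>R u + cross u (w - z) *\<^sub>R v)" by simp
  then have "w - z = (cross (w - z) v / cross u v) *\<^sub>R u + (cross u (w - z) / cross u v) *\<^sub>R v"
    using assms by (simp add: scaleR_add_right)
  then show "w = pt z u v (cross (w - z) v / cross u v) (cross u (w - z) / cross u v)"
    by (simp add: pt_def algebra_simps)
qed

text \<open>
  The origin \<open>z\<close> is the intersection of the diagonals.  It divides \<open>ac\<close> in the ratio of the areas of
  \<open>abd\<close> and \<open>bcd\<close>, and \<open>bd\<close> in the ratio of the areas of \<open>abc\<close> and \<open>acd\<close>.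
\<close>

lemma diagonal_frame:
  assumes "ccw [a, b, c, d]"
  obtains z u v s t where "0 < cross u v" "0 < s" "0 < t"
    "a = pt z u v 1 0" "b = pt z u v 0 1" "c = pt z u v (- s) 0" "d = pt z u v 0 (- t)"
proof -
  have pos: "0 < orient a b c" "0 < orient a b d" "0 < orient a c d" "0 < orient b c d"
    using assms by auto
  define \<Delta> where "\<Delta> = quad a b c d"
  have D: "\<Delta> = orient a b c + orient a c d" "\<Delta> = orient a b d + orient b c d"
    by (simp_all add: \<Delta>_def quad_def orient_coords algebra_simps)
  define l m where "l = orient a b d / \<Delta>" and "m = orient a b c / \<Delta>"
  have lm: "0 < l" "l < 1" "0 < m" "m < 1" using pos D by (auto simp: l_def m_def)
  define z where "z = a + l *\<^sub>R (c - a)"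
  have "\<Delta> *\<^sub>R a + orient a b d *\<^sub>R (c - a) = \<Delta> *\<^sub>R b + orient a b c *\<^sub>R (d - b)"
    by (simp add: vec_eq_iff forall_2 \<Delta>_def quad_def orient_coords) (simp add: algebra_simps)
  then have "(1 / \<Delta>) *\<^sub>R (\<Delta> *\<^sub>R a + orient a b d *\<^sub>R (c - a)) =
      (1 / \<Delta>) *\<^sub>R (\<Delta> *\<^sub>R b + orient a b c *\<^sub>R (d - b))" by simp
  then have z: "z = b + m *\<^sub>R (d - b)"
    using D pos by (simp add: z_def l_def m_def scaleR_add_right)
  have scale: "x = y" if "k *\<^sub>R x = k *\<^sub>R y" "0 < k" for x y :: "real ^ 2" and k using that by simp
  have "l *\<^sub>R (c - z) = - ((1 - l) *\<^sub>R (a - z))"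
    by (simp add: z_def algebra_simps)
  then have cz: "c - z = - ((1 - l) / l) *\<^sub>R (a - z)"
    by (rule_tac scale[OF _ lm(1)]) (use lm in simp)
  have c: "c = z + (- ((1 - l) / l)) *\<^sub>R (a - z)" by (simp only: cz[symmetric]) simp
  have "m *\<^sub>R (d - z) = - ((1 - m) *\<^sub>R (b - z))"
    by (simp add: z algebra_simps)
  then have dz: "d - z = - ((1 - m) / m) *\<^sub>R (b - z)"
    by (rule_tac scale[OF _ lm(3)]) (use lm in simp)
  have d: "d = z + (- ((1 - m) / m)) *\<^sub>R (b - z)" by (simp only: dz[symmetric]) simp
  have "cross (a - z) (b - z) = l * orient a b c"
    by (simp add: z_def orient_coords) (simp add: algebra_simps)
  then have "0 < cross (a - z) (b - z)" using lm pos by simp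
  moreover have "0 < (1 - l) / l" "0 < (1 - m) / m" using lm by auto
  moreover have "a = pt z (a - z) (b - z) 1 0" "b = pt z (a - z) (b - z) 0 1" by (simp_all add: pt_def)
  moreover have "c = pt z (a - z) (b - z) (- ((1 - l) / l)) 0"
    unfolding pt_def using c by (simp only: scaleR_zero_left add_0_right)
  moreover have "d = pt z (a - z) (b - z) 0 (- ((1 - m) / m))"
    unfolding pt_def using d by (simp only: scaleR_zero_left add_0_right)
  ultimately show ?thesis by (rule that)
qed

section \<open>Polynomial inequalities for the deleted points\<close>

text \<open>
  The deleted points are \<open>(x\<^sub>1, x\<^sub>2)\<close> beyond the side from \<open>(1,0)\<close> to \<open>(0,1)\<close> and \<open>(-y\<^sub>1, -y\<^sub>2)\<close> beyond the
  side from \<open>(-s,0)\<close> to \<open>(0,-t)\<close>.  Their ears are at most \<open>1\<close> and \<open>s t\<close>, and \<open>1 + s t\<close> is small enough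
  unless \<open>s\<close> and \<open>t\<close> lie on the same side of \<open>1\<close>.  In that case the loss is compared with one other
  deletion: that of the ends of the negative half-axes if \<open>s, t < 1\<close>, that of the
  ends of the positive half-axes if \<open>s, t > 1\<close>.
\<close>

lemma opposite_scalar:
  fixes x1 x2 y1 y2 s t :: real
  assumes s: "0 < s" and t: "0 < t" and x: "x1 \<le> 1" "x2 \<le> 1" "1 \<le> x1 + x2"
    and y: "y1 \<le> s" "y2 \<le> t" "s * t \<le> t * y1 + s * y2"
    and T02: "(x1 + x2 - 1) + (t * y1 + s * y2 - s * t) \<le> s + t - (t - 1) * x1 - (s - 1) * x2"
    and T35: "(x1 + x2 - 1) + (t * y1 + s * y2 - s * t) \<le> s + t - (1 - t) * y1 - (1 - s) * y2"
  shows "2 * ((x1 + x2 - 1) + (t * y1 + s * y2 - s * t)) \<le> (1 + s) * (1 + t)" (is "2 * ?L \<le> _")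
proof -
  have L: "?L \<le> 1 + s * t"
  proof -
    have "t * y1 \<le> t * s" "s * y2 \<le> s * t" using s t y by auto
    then show ?thesis using x by (simp add: algebra_simps)
  qed
  consider "(1 - s) * (1 - t) \<le> 0" | "s < 1" "t < 1" | "1 < s" "1 < t"
    by (metis linorder_neqE_linordered_idom mult_eq_0_iff diff_gt_0_iff_gt mult_neg_pos mult_pos_neg
        order_le_less right_minus_eq less_iff_diff_less_0)
  then show ?thesis
  proof cases
    case 1
    then show ?thesis using L by (simp add: algebra_simps)
  next
    case 2
    have "s * t \<le> t * y1 + s * t" using y s by (smt (verit) mult_left_mono)
    then have y1: "0 \<le> y1" using t by (simp add: zero_le_mult_iff)
    have "s * t \<le> t * s + s * y2" using y t by (smt (verit) mult_left_mono)
    then have y2: "0 \<le> y2" using s by (simp add: zero_le_mult_iff)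
    show ?thesis
    proof (cases "s \<le> t")
      case True
      have "0 \<le> (1 - t) * (t * y1 + s * y2 - s * t)" "0 \<le> (t - s) * y2" using y 2 y2 True by auto
      then have "t * (s * (1 - t)) \<le> t * ((1 - t) * y1 + (1 - s) * y2)" by (simp add: algebra_simps)
      then have "s * (1 - t) \<le> (1 - t) * y1 + (1 - s) * y2" using s t by simp
      then have "?L \<le> t * (1 + s)" using T35 t by (simp add: algebra_simps)
      moreover have "0 \<le> (1 - t) * (1 + s)" using 2 s by simp
      ultimately show ?thesis by (simp add: algebra_simps)
    next
      case False
      have "0 \<le> (1 - s) * (t * y1 + s * y2 - s * t)" "0 \<le> (s - t) * y1" using y 2 y1 False by auto
      then have "s * (t * (1 - s)) \<le> s * ((1 - t) * y1 + (1 - s) * y2)" by (simp add: algebra_simps)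
      then have "t * (1 - s) \<le> (1 - t) * y1 + (1 - s) * y2" using s t by simp
      then have "?L \<le> s * (1 + t)" using T35 s by (simp add: algebra_simps)
      moreover have "0 \<le> (1 - s) * (1 + t)" using 2 t by simp
      ultimately show ?thesis by (simp add: algebra_simps)
    qed
  next
    case 3
    show ?thesis
    proof (cases "s \<le> t")
      case True
      have "0 \<le> (s - 1) * (x1 + x2 - 1)" "0 \<le> (t - s) * x1" using x 3 True by auto
      then have "?L \<le> 1 + t" using T02 by (simp add: algebra_simps)
      moreover have "0 \<le> (s - 1) * (1 + t)" using 3 by simp
      ultimately show ?thesis by (simp add: algebra_simps)
    next
      case False
      have "0 \<le> (t - 1) * (x1 + x2 - 1)" "0 \<le> (s - t) * x2" using x 3 False by auto
      then have "?L \<le> 1 + s" using T02 by (simp add: algebra_simps)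
      moreover have "0 \<le> (t - 1) * (1 + s)" using 3 by simp
      ultimately show ?thesis by (simp add: algebra_simps)
    qed
  qed
qed

text \<open>
  The hexagon is \<open>(1,0)\<close>, \<open>x = (1 - p, 1 - e)\<close>, \<open>(0,1)\<close>, \<open>y = (- s (1 - q), 1 - f)\<close>, \<open>(-s,0)\<close>, \<open>(0,-t)\<close>,
  and \<open>x\<close>, \<open>y\<close> are deleted.  In this order the ears are
  \<open>T\<^sub>0 = 1 - e + t p\<close>, \<open>T\<^sub>1 = 1 - p - e\<close>, \<open>T\<^sub>2 = (1 - p) f + s (1 - q) e\<close>, \<open>T\<^sub>3 = s (1 - q - f)\<close>,
  \<open>T\<^sub>4 = s (1 - f + t q)\<close>, \<open>T\<^sub>5 = t (1 + s)\<close>, and the loss is \<open>L = T\<^sub>1 + T\<^sub>3\<close>.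

  Since \<open>(1 + s)(1 + t) = 1 + s + T\<^sub>5\<close>, the bound follows from \<open>L \<le> T\<^sub>2 + T\<^sub>5\<close> as soon as \<open>L + T\<^sub>2 \<le> 1 + s\<close>,
  and from \<open>T\<^sub>1 \<le> T\<^sub>5\<close> as soon as \<open>T\<^sub>1 + 2 T\<^sub>3 \<le> 1 + s\<close>.  The first condition holds unless
  \<open>0 < f\<close> and \<open>e < f\<close>.  If both fail, then for \<open>t < 1\<close> the inequality \<open>L \<le> T\<^sub>2 + T\<^sub>4\<close> is contradictory.
  For \<open>t \<ge> 1\<close> the bound to be proved for \<open>L\<close> is at least \<open>1 + s\<close>, which suffices if \<open>e \<ge> 0\<close>; if \<open>e < 0\<close>, then
  \<open>L \<le> T\<^sub>2 + T\<^sub>4\<close> bounds \<open>L\<close> by the mean of \<open>1\<close> and \<open>s (1 + t)\<close> with weights \<open>1 - q\<close> and \<open>q\<close>.  The coordinates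
  \<open>e\<close> and \<open>f\<close> may be negative, though not both, because the ear \<open>T\<^sub>2\<close> is positive.
\<close>

lemma distance_two_scalar_short:
  fixes p e q f s t :: real
  assumes s: "0 < s" "s \<le> 1" and t: "0 < t" and p: "0 \<le> p" "p < 1" and q: "0 \<le> q" "q < 1"
    and T1: "p + e < 1" and T3: "q + f < 1" and T2: "0 < (1 - p) * f + s * (1 - q) * e"
    and T15: "1 - p - e \<le> t * (1 + s)"
    and T25: "1 - p - e + s * (1 - q - f) \<le> (1 - p) * f + s * (1 - q) * e + t * (1 + s)"
    and T24: "1 - p - e + s * (1 - q - f) \<le> (1 - p) * f + s * (1 - q) * e + s * (1 - f + t * q)"
  shows "2 * (1 - p - e + s * (1 - q - f)) \<le> (1 + s) * (1 + t)"
proof -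
  define L where "L = 1 - p - e + s * (1 - q - f)"
  \<comment> \<open>\<open>T\<close> is the ear \<open>T\<^sub>2\<close> between the two deleted points.\<close>
  define T where "T = (1 - p) * f + s * (1 - q) * e"
  have use25: ?thesis if "L + T \<le> 1 + s"
    using that T25 unfolding L_def T_def by (simp add: algebra_simps)
  have use15: ?thesis if "1 - p - e + 2 * (s * (1 - q - f)) \<le> 1 + s"
    using that T15 by (simp add: algebra_simps)
  have LT: "1 + s - (L + T) = p + s * q + p * f + s * q * e - (1 - s) * (f - e)"
    unfolding L_def T_def by (simp add: algebra_simps)
  show ?thesis
  proof (cases "0 < f \<and> e < f")
    case False
    have "L + T \<le> 1 + s"
    proof (cases "f \<le> 0")
      case True
      have e: "0 < e"
      proof (rule ccontr)
        assume "\<not> 0 < e"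
        then have "s * (1 - q) * e \<le> 0" "(1 - p) * f \<le> 0"
          using True s q p by (auto intro!: mult_nonneg_nonpos)
        then show False using T2 by linarith
      qed
      have "(1 - p) * (- f) \<le> s * (1 - q) * e" using T2 by linarith
      also have "\<dots> \<le> s * 1 * (1 - p)"
        using s q e T1 by (intro mult_mono) auto
      finally have "(- f) * (1 - p) \<le> s * (1 - p)" by (simp add: mult.commute)
      then have g: "- f \<le> s" using p by (intro mult_right_le_imp_le[of "- f" "1 - p" s]) auto
      have "(- f) * (s - (1 - p)) \<le> p"
      proof (cases "s \<le> 1 - p")
        case le: True
        then have "(- f) * (s - (1 - p)) \<le> 0" using True by (intro mult_nonneg_nonpos) auto
        then show ?thesis using p by linarith
      next
        case False
        then have "(- f) * (s - (1 - p)) \<le> s * (s - (1 - p))"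
          using g by (intro mult_right_mono) auto
        moreover have "0 \<le> (1 - s) * (s + p)" using s p by simp
        ultimately show ?thesis by (simp add: algebra_simps)
      qed
      moreover have "0 \<le> s * q" "0 \<le> s * q * e" "0 \<le> (1 - s) * e" using s q e by auto
      ultimately show ?thesis using LT by (simp add: algebra_simps)
    next
      case f: False
      then have "f \<le> e" using False by auto
      then have "0 \<le> (1 - s) * (e - f)" using s by simp
      moreover have "0 \<le> s * q" "0 \<le> s * q * e" "0 \<le> p * f" using s q p f \<open>f \<le> e\<close> by auto
      ultimately show ?thesis using LT p by (simp add: algebra_simps)
    qed
    then show ?thesis by (rule use25)
  next
    case True
    show ?thesis
    proof (cases "s \<le> p + e + 2 * s * (q + f)")
      case True
      then show ?thesis by (intro use15) (simp add: algebra_simps)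
    next
      case neg: False
      have pf: "0 \<le> p * f" using p True by simp
      have sq: "0 \<le> s * q" using s q by simp
      have f1: "f \<le> 1" using T3 q by linarith
      show ?thesis
      proof (cases "t < 1")
        case t1: True
        have "s * q * t \<le> s * q * 1" using t1 sq by (intro mult_left_mono) auto
        moreover have "1 \<le> s * q * t + f - p * f + s * ((1 - q) * e) + p + e + s * q"
          using T24 by (simp add: algebra_simps)
        ultimately have *: "1 < f + s * ((1 - q) * e) + s - 2 * (s * f)"
          using neg pf by (simp add: algebra_simps)
        have False
        proof (cases "e \<le> 0")
          case e: True
          have "s * ((1 - q) * e) \<le> 0" using e s q by (auto intro!: mult_nonneg_nonpos)
          moreover have "0 \<le> (1 - f) * (1 - s)" "0 < s * f" using f1 s True by auto
          ultimately show False using * by (simp add: algebra_simps)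
        next
          case e: False
          have "s * ((1 - q) * e) \<le> s * (1 * f)"
            using e s q True by (intro mult_left_mono mult_mono) auto
          moreover have "0 \<le> (1 - f) * (1 - s)" using f1 s by auto
          ultimately show False using * by (simp add: algebra_simps)
        qed
        then show ?thesis ..
      next
        case t1: False
        have ts: "0 \<le> (1 + s) * (t - 1)" using s t1 by simp
        show ?thesis
        proof (cases "0 \<le> e")
          case True
          have "0 < s * f" using \<open>0 < f \<and> e < f\<close> s by simp
          then have "L \<le> 1 + s" unfolding L_def using True p sq by (simp add: algebra_simps)
          then show ?thesis using ts unfolding L_def by (simp add: algebra_simps)
        next
          case e: False
          have "s * ((1 - q) * e) \<le> 0" using e s q by (auto intro!: mult_nonneg_nonpos)
          then have "L \<le> f * (1 - s) + s + s * q * t"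
            using T24 pf unfolding L_def by (simp add: algebra_simps)
          also have "\<dots> \<le> (1 - q) * (1 - s) + s + s * q * t"
            using T3 s by (intro add_right_mono mult_right_mono) auto
          finally have "L \<le> (1 - q) * 1 + q * (s * (1 + t))" by (simp add: algebra_simps)
          moreover have "0 \<le> (1 - q) * ((1 + s) * (1 + t) - 2)"
          proof -
            have "1 * 2 \<le> (1 + s) * (1 + t)" using s t1 by (intro mult_mono) auto
            then show ?thesis using q by simp
          qed
          moreover have "0 \<le> q * ((1 - s) * (1 + t))" using q s t by simp
          ultimately show ?thesis unfolding L_def[symmetric] by (simp add: algebra_simps)
        qed
      qed
    qed
  qed
qed

text \<open>
  Reflecting the hexagon exchanges the two deleted points.  After rescaling the first axis this
  swaps \<open>(p, e)\<close> with \<open>(q, f)\<close> and replaces \<open>s\<close> by \<open>1 / s\<close>, so that \<open>s \<le> 1\<close> can be assumed.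
\<close>

lemma distance_two_scalar:
  fixes p e q f s t :: real
  assumes s: "0 < s" and t: "0 < t" and p: "0 \<le> p" "p < 1" and q: "0 \<le> q" "q < 1"
    and T1: "p + e < 1" and T3: "q + f < 1" and T2: "0 < (1 - p) * f + s * (1 - q) * e"
    and T15: "1 - p - e \<le> t * (1 + s)" and T35: "s * (1 - q - f) \<le> t * (1 + s)"
    and T25: "1 - p - e + s * (1 - q - f) \<le> (1 - p) * f + s * (1 - q) * e + t * (1 + s)"
    and T24: "1 - p - e + s * (1 - q - f) \<le> (1 - p) * f + s * (1 - q) * e + s * (1 - f + t * q)"
    and T20: "1 - p - e + s * (1 - q - f) \<le> (1 - p) * f + s * (1 - q) * e + (1 - e + t * p)"
  shows "2 * (1 - p - e + s * (1 - q - f)) \<le> (1 + s) * (1 + t)"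
proof (cases "s \<le> 1")
  case True
  then show ?thesis using assms by (intro distance_two_scalar_short) auto
next
  case False
  have scale: "x \<le> y" if "s * x \<le> s * y" for x y :: real using that s by simp
  have "2 * (1 - q - f + (1 / s) * (1 - p - e)) \<le> (1 + 1 / s) * (1 + t)"
  proof (rule distance_two_scalar_short)
    show "0 < (1 - q) * e + 1 / s * (1 - p) * f"
    proof -
      have "(1 - q) * e + 1 / s * (1 - p) * f = ((1 - p) * f + s * (1 - q) * e) / s"
        using s by (simp add: field_simps)
      then show ?thesis using T2 s by simp
    qed
    show "1 - q - f \<le> t * (1 + 1 / s)"
      by (rule scale) (use T35 s in \<open>simp add: algebra_simps add_divide_distrib diff_divide_distrib\<close>)
    show "1 - q - f + 1 / s * (1 - p - e) \<le> (1 - q) * e + 1 / s * (1 - p) * f + t * (1 + 1 / s)"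
      by (rule scale) (use T25 s in \<open>simp add: algebra_simps add_divide_distrib diff_divide_distrib\<close>)
    show "1 - q - f + 1 / s * (1 - p - e) \<le> (1 - q) * e + 1 / s * (1 - p) * f + 1 / s * (1 - e + t * p)"
      by (rule scale) (use T20 s in \<open>simp add: algebra_simps add_divide_distrib diff_divide_distrib\<close>)
  qed (use assms False in auto)
  then have "s * (2 * (1 - q - f + (1 / s) * (1 - p - e))) \<le> s * ((1 + 1 / s) * (1 + t))" using s by simp
  then show ?thesis using s by (simp add: algebra_simps add_divide_distrib diff_divide_distrib)
qed

section \<open>Cutting two ears off a hexagon\<close>

text \<open>
  Each of the nine quadrilaterals arises from the hexagon \<open>abcdef\<close> by deleting two vertices
  that are not neighbours.
\<close>

definition nonadjacent_le where
  "nonadjacent_le N a b c d e f \<longleftrightarrow>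
     quad b d e f \<le> N \<and> quad b c e f \<le> N \<and> quad b c d f \<le> N \<and> quad a c e f \<le> N \<and>
     quad a c d f \<le> N \<and> quad a c d e \<le> N \<and> quad a b d f \<le> N \<and> quad a b d e \<le> N \<and> quad a b c e \<le> N"

lemma nonadjacent_le_rotate: "nonadjacent_le N a b c d e f \<Longrightarrow> nonadjacent_le N b c d e f a"
  unfolding nonadjacent_le_def by (simp add: quad_rotate[of _ _ _ a])

lemma ccw6_rotate: "ccw [a, b, c, d, e, f] \<Longrightarrow> ccw [b, c, d, e, f, a]"
  by (simp add: orient_rotate[where a = a])

lemma pos_cancel: "0 < c \<Longrightarrow> 0 < r * c \<longleftrightarrow> 0 < (r :: real)"
  by (simp add: zero_less_mult_iff)

text \<open>
  The two deleted vertices are \<open>x\<close> and \<open>y\<close>.  Comparison with the four deletions that keep one of \<open>x\<close>,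
  \<open>y\<close> confines these points to the corners cut out by parallels to the diagonals of \<open>abcd\<close>; the two
  remaining comparisons delete \<open>a, b\<close> or \<open>c, d\<close> instead.
\<close>

lemma opposite_cut:
  assumes ccw: "ccw [a, x, b, c, y, d]" and N: "nonadjacent_le (quad a b c d) a x b c y d"
  shows "2 * fan a [x, b, c, y, d] \<le> 3 * quad a b c d"
proof -
  have "ccw [a, b, c, d]" using ccw by simp
  then obtain z u v s t where uv: "0 < cross u v" and st: "0 < s" "0 < t" and
    abcd: "a = pt z u v 1 0" "b = pt z u v 0 1" "c = pt z u v (- s) 0" "d = pt z u v 0 (- t)"
    by (rule diagonal_frame)
  obtain x1 x2 where x: "x = pt z u v x1 x2" using uv by (metis ex_pt less_irrefl)
  obtain y1' y2' where "y = pt z u v y1' y2'" using uv by (metis ex_pt less_irrefl)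
  then obtain y1 y2 where y: "y = pt z u v (- y1) (- y2)" by (metis minus_minus)
  have ears: "0 < orient a x b" "0 < orient c y d" using ccw by auto
  have quads: "quad x b c d \<le> quad a b c d" "quad a x c d \<le> quad a b c d" "quad a b y d \<le> quad a b c d"
    "quad a b c y \<le> quad a b c d" "quad x c y d \<le> quad a b c d" "quad a x b y \<le> quad a b c d"
    using N by (auto simp: nonadjacent_le_def)
  note quads' = quads[unfolded x y abcd quad_pt mult_le_cancel_right_pos[OF uv]]
  have "x1 * (1 + t) \<le> 1 * (1 + t)" "x2 * (1 + s) \<le> 1 * (1 + s)" "y1 * (1 + t) \<le> s * (1 + t)"
      "y2 * (1 + s) \<le> t * (1 + s)"
    using quads'(1-4) by (simp_all add: algebra_simps)
  then have le: "x1 \<le> 1" "x2 \<le> 1" "y1 \<le> s" "y2 \<le> t" using st by simp_all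
  have ge: "1 \<le> x1 + x2" "s * t \<le> t * y1 + s * y2"
    using ears[unfolded x y abcd orient_pt pos_cancel[OF uv]] by (simp_all add: algebra_simps)
  have "2 * ((x1 + x2 - 1) + (t * y1 + s * y2 - s * t)) \<le> (1 + s) * (1 + t)"
    using quads'(5,6)
    by (intro opposite_scalar st le ge) (simp_all add: algebra_simps)
  then have "(2 * ((x1 + x2 - 1) + (t * y1 + s * y2 - s * t))) * cross u v \<le> ((1 + s) * (1 + t)) * cross u v"
    using uv by (intro mult_right_mono) auto
  moreover have "quad a b c d = (1 + s) * (1 + t) * cross u v"
    unfolding abcd quad_pt by (simp add: algebra_simps)
  moreover have "fan a [x, b, c, y, d] = quad a b c d + orient a x b + orient c y d"
    by (simp add: quad_def orient_coords algebra_simps)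
  moreover have "orient a x b + orient c y d = ((x1 + x2 - 1) + (t * y1 + s * y2 - s * t)) * cross u v"
    unfolding x y abcd orient_pt by (simp add: algebra_simps)
  ultimately show ?thesis by (simp add: algebra_simps)
qed

text \<open>
  Here only the neighbour \<open>b\<close> separates the deleted vertices \<open>x\<close> and \<open>y\<close>.  The coordinates are written
  as deviations from \<open>(1, 1)\<close> and \<open>(- s, 1)\<close>, the apexes of the parallelograms spanned by half-diagonals
  over the sides \<open>ab\<close> and \<open>bc\<close>; the unit on the negative first half-axis is \<open>s\<close>.
\<close>

lemma distance_two_cut:
  assumes ccw: "ccw [a, x, b, y, c, d]" and N: "nonadjacent_le (quad a b c d) a x b y c d"
  shows "2 * fan a [x, b, y, c, d] \<le> 3 * quad a b c d"
proof -
  have "ccw [a, b, c, d]" using ccw by simp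
  then obtain z u v s t where uv: "0 < cross u v" and st: "0 < s" "0 < t" and
    abcd: "a = pt z u v 1 0" "b = pt z u v 0 1" "c = pt z u v (- s) 0" "d = pt z u v 0 (- t)"
    by (rule diagonal_frame)
  obtain x1 x2 where x': "x = pt z u v x1 x2" using uv by (metis ex_pt less_irrefl)
  define p e where "p = 1 - x1" and "e = 1 - x2"
  have x: "x = pt z u v (1 - p) (1 - e)" by (simp add: x' p_def e_def)
  obtain y1 y2 where y': "y = pt z u v y1 y2" using uv by (metis ex_pt less_irrefl)
  define q f where "q = 1 + y1 / s" and "f = 1 - y2"
  have y: "y = pt z u v (- s * (1 - q)) (1 - f)" using st by (simp add: y' q_def f_def)
  have ori: "0 < orient a x b" "0 < orient x b y" "0 < orient b y c" "0 < orient x b d" "0 < orient b y d"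
    using ccw by auto
  have quads: "quad x b c d \<le> quad a b c d" "quad a b y d \<le> quad a b c d"
    "quad a x b c \<le> quad a b c d" "quad a b y c \<le> quad a b c d"
    "quad a x y c \<le> quad a b c d" "quad a x y d \<le> quad a b c d" "quad x y c d \<le> quad a b c d"
    using N by (auto simp: nonadjacent_le_def)
  note quads' = quads[unfolded x y abcd quad_pt mult_le_cancel_right_pos[OF uv]]
  have "0 \<le> p * (1 + t)" "0 \<le> s * (q * (1 + t))"
    using quads'(1,2) by (simp_all add: algebra_simps)
  then have pq: "0 \<le> p" "0 \<le> q" using st by (simp_all add: zero_le_mult_iff)
  have "0 < (1 - p) * (1 + t)" "0 < s * ((1 - q) * (1 + t))"
    using ori(4,5)[unfolded x y abcd orient_pt pos_cancel[OF uv]] by (simp_all add: algebra_simps)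
  then have pq1: "p < 1" "q < 1" using st by (simp_all add: zero_less_mult_iff)
  have "0 < s * (1 - q - f)"
    using ori(3)[unfolded x y abcd orient_pt pos_cancel[OF uv]] by (simp_all add: algebra_simps)
  then have T3: "q + f < 1" using st by (simp add: zero_less_mult_iff)
  have T12: "p + e < 1" "0 < (1 - p) * f + s * (1 - q) * e"
    using ori(1,2)[unfolded x y abcd orient_pt pos_cancel[OF uv]] by (simp_all add: algebra_simps)
  have "2 * (1 - p - e + s * (1 - q - f)) \<le> (1 + s) * (1 + t)"
    using quads'(3-)
    by (intro distance_two_scalar st pq pq1 T3 T12) (simp_all add: algebra_simps)
  then have "(2 * (1 - p - e + s * (1 - q - f))) * cross u v \<le> ((1 + s) * (1 + t)) * cross u v"
    using uv by (intro mult_right_mono) auto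
  moreover have "quad a b c d = (1 + s) * (1 + t) * cross u v"
    unfolding abcd quad_pt by (simp add: algebra_simps)
  moreover have "fan a [x, b, y, c, d] = quad a b c d + orient a x b + orient b y c"
    by (simp add: quad_def orient_coords algebra_simps)
  moreover have "orient a x b + orient b y c = (1 - p - e + s * (1 - q - f)) * cross u v"
    unfolding x y abcd orient_pt by (simp add: algebra_simps)
  ultimately show ?thesis by (simp add: algebra_simps)
qed

text \<open>
  Rotating the labels moves the largest of the nine quadrilaterals to the position of \<open>opposite_cut\<close>
  or of \<open>distance_two_cut\<close>, for three and six of them respectively.
\<close>

lemma hexagon_cut:
  assumes ccw: "ccw [a, b, c, d, e, f]" and M: "nonadjacent_le M a b c d e f"
  shows "2 * fan a [b, c, d, e, f] \<le> 3 * M"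
proof -
  define A where "A = fan a [b, c, d, e, f]"
  have A: "A = fan a [b, c, d, e, f]" "A = fan b [c, d, e, f, a]" "A = fan c [d, e, f, a, b]"
    "A = fan d [e, f, a, b, c]" "A = fan e [f, a, b, c, d]" "A = fan f [a, b, c, d, e]"
    unfolding A_def by (simp_all add: orient_coords algebra_simps)
  note ccws = ccw ccw[THEN ccw6_rotate] ccw[THEN ccw6_rotate, THEN ccw6_rotate]
    ccw[THEN ccw6_rotate, THEN ccw6_rotate, THEN ccw6_rotate]
    ccw[THEN ccw6_rotate, THEN ccw6_rotate, THEN ccw6_rotate, THEN ccw6_rotate]
    ccw[THEN ccw6_rotate, THEN ccw6_rotate, THEN ccw6_rotate, THEN ccw6_rotate, THEN ccw6_rotate]
  let ?Q = "{quad b d e f, quad b c e f, quad b c d f, quad a c e f, quad a c d f, quad a c d e,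
    quad a b d f, quad a b d e, quad a b c e}"
  define N where "N = Max ?Q"
  have "N \<in> ?Q" unfolding N_def by (rule Max_in) auto
  have "q \<le> N" if "q \<in> ?Q" for q unfolding N_def using that by (intro Max_ge) auto
  then have n1: "nonadjacent_le N a b c d e f" by (simp add: nonadjacent_le_def)
  then have n2: "nonadjacent_le N b c d e f a" by (rule nonadjacent_le_rotate)
  then have n3: "nonadjacent_le N c d e f a b" by (rule nonadjacent_le_rotate)
  then have n4: "nonadjacent_le N d e f a b c" by (rule nonadjacent_le_rotate)
  then have n5: "nonadjacent_le N e f a b c d" by (rule nonadjacent_le_rotate)
  then have n6: "nonadjacent_le N f a b c d e" by (rule nonadjacent_le_rotate)
  have "2 * A \<le> 3 * N"
  proof -
    have eqs: "quad b d e f = quad f b d e" "quad b c e f = quad c e f b" "quad b c d f = quad d f b c"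
      "quad a c d e = quad e a c d" "quad a b d f = quad b d f a" "quad a b d e = quad b d e a"
      "quad a b c e = quad c e a b"
      by (simp_all add: quad_def cross_def algebra_simps)
    consider "N = quad a c d f" | "N = quad b d e a" | "N = quad c e f b"
      | "N = quad a c e f" | "N = quad b d f a" | "N = quad c e a b" | "N = quad d f b c"
      | "N = quad e a c d" | "N = quad f b d e"
      using \<open>N \<in> ?Q\<close> unfolding eqs insert_iff empty_iff by blast
    then show ?thesis
    proof cases
      case 1 show ?thesis unfolding A(1) 1 by (rule opposite_cut[OF ccws(1) n1[unfolded 1]])
    next
      case 2 show ?thesis unfolding A(2) 2 by (rule opposite_cut[OF ccws(2) n2[unfolded 2]])
    next
      case 3 show ?thesis unfolding A(3) 3 by (rule opposite_cut[OF ccws(3) n3[unfolded 3]])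
    next
      case 4 show ?thesis unfolding A(1) 4 by (rule distance_two_cut[OF ccws(1) n1[unfolded 4]])
    next
      case 5 show ?thesis unfolding A(2) 5 by (rule distance_two_cut[OF ccws(2) n2[unfolded 5]])
    next
      case 6 show ?thesis unfolding A(3) 6 by (rule distance_two_cut[OF ccws(3) n3[unfolded 6]])
    next
      case 7 show ?thesis unfolding A(4) 7 by (rule distance_two_cut[OF ccws(4) n4[unfolded 7]])
    next
      case 8 show ?thesis unfolding A(5) 8 by (rule distance_two_cut[OF ccws(5) n5[unfolded 8]])
    next
      case 9 show ?thesis unfolding A(6) 9 by (rule distance_two_cut[OF ccws(6) n6[unfolded 9]])
    qed
  qed
  moreover have "N \<le> M" using M \<open>N \<in> ?Q\<close> by (auto simp: nonadjacent_le_def)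
  ultimately show ?thesis by (simp add: A_def)
qed

lemma hexagon_ratio_ge:
  assumes P: "convex_ngon 6 P"
  shows "2 / 3 \<le> max_area_ratio 4 P"
proof -
  note V = ngon_vertices[OF P]
  let ?V = "{v. v extreme_point_of P}"
  define M where "M = Max ((\<lambda>(p, q, r, s). quad p q r s) ` (?V \<times> ?V \<times> ?V \<times> ?V))"
  have eq: "max_area_ratio 4 P = M / 2 / measure lborel P"
    unfolding M_def by (rule max_area_ratio_eq[OF P]) simp
  have M: "quad p q r s \<le> M" if "p \<in> ?V" "q \<in> ?V" "r \<in> ?V" "s \<in> ?V" for p q r s
    unfolding M_def using that V(1) by (intro Max_ge) (simp, force)
  obtain xs where xs: "set xs = {v. v extreme_point_of P}" "distinct xs" "ccw xs"
    using convex_independent_ccw[OF V(1,3)] .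
  then have "length xs = 6" using V by (metis distinct_card)
  then obtain a b c d e f where abc: "xs = [a, b, c, d, e, f]"
    by (auto simp: numeral_eq_Suc length_Suc_conv)
  have ccw: "ccw [a, b, c, d, e, f]" using xs abc by simp
  have V6: "a \<in> ?V" "b \<in> ?V" "c \<in> ?V" "d \<in> ?V" "e \<in> ?V" "f \<in> ?V"
    unfolding xs(1)[symmetric] abc by simp_all
  have area: "measure lborel P = fan a [b, c, d, e, f] / 2"
    using ccw_fan_area[OF ccw] V(4) xs(1) abc by simp
  have "2 * fan a [b, c, d, e, f] \<le> 3 * M"
    by (rule hexagon_cut[OF ccw]) (simp add: nonadjacent_le_def M V6 del: mem_Collect_eq)
  moreover have "0 < fan a [b, c, d, e, f]" using ccw by (simp add: add_pos_pos)
  ultimately show ?thesis unfolding eq area by (simp add: field_simps)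
qed

section \<open>The extremal hexagon\<close>

text \<open>
  An affine image of the regular hexagon with integer coordinates; its hull is the unit ball
  \<open>\<bar>x\<bar>, \<bar>y\<bar>, \<bar>x - y\<bar> \<le> 1\<close> of a norm.
\<close>

definition hexagon_vertices :: "(real ^ 2) list" where
  "hexagon_vertices = [vector [1, 0], vector [1, 1], vector [0, 1],
     vector [- 1, 0], vector [- 1, - 1], vector [0, - 1]]"

text \<open>
  The vertices lie on the ellipse \<open>x\<^sup>2 - x y + y\<^sup>2 = 1\<close>, and the tangent at \<open>h\<close> keeps the other vertices
  on one side.
\<close>

lemma hexagon_vertices_independent: "convex_independent (set hexagon_vertices)"
  unfolding convex_independent_def
proof
  fix h assume h: "h \<in> set hexagon_vertices"
  \<comment> \<open>The tangent functional at \<open>h\<close> takes the value 2 at \<open>h\<close>, and at most 1 at the other vertices.\<close>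
  let ?l = "\<lambda>y :: real ^ 2. (2 * h $ 1 - h $ 2) * y $ 1 + (2 * h $ 2 - h $ 1) * y $ 2"
  have "convex {y :: real ^ 2. vector [2 * h $ 1 - h $ 2, 2 * h $ 2 - h $ 1] \<bullet> y \<le> (1 :: real)}"
    by (rule convex_halfspace_le)
  then have "convex {y. ?l y \<le> 1}" by (simp add: inner_vec_def sum_2)
  moreover have "set hexagon_vertices - {h} \<subseteq> {y. ?l y \<le> 1}"
    using h by (auto simp: hexagon_vertices_def)
  ultimately have "convex hull (set hexagon_vertices - {h}) \<subseteq> {y. ?l y \<le> 1}"
    by (intro hull_minimal)
  moreover have "1 < ?l h" using h by (auto simp: hexagon_vertices_def)
  ultimately show "h \<notin> convex hull (set hexagon_vertices - {h})" by auto
qed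

lemma hexagon_vertices_ccw: "ccw hexagon_vertices"
  by (simp add: hexagon_vertices_def orient_coords)

text \<open>
  Two vectors in the twofold hexagon.  The three estimates resolve the first vector along the
  three pairs of edge directions of the hexagon, and for any vector one of the three resolutions costs only
  its hexagonal norm.
\<close>

lemma hexagonal_norm_cross_le:
  fixes x1 x2 y1 y2 :: real
  assumes "\<bar>x1\<bar> \<le> 2" "\<bar>x2\<bar> \<le> 2" "\<bar>x1 - x2\<bar> \<le> 2" and y: "\<bar>y1\<bar> \<le> 2" "\<bar>y2\<bar> \<le> 2" "\<bar>y1 - y2\<bar> \<le> 2"
  shows "x1 * y2 - x2 * y1 \<le> 4"
proof -
  have bound: "r * w \<le> \<bar>r\<bar> * 2" if "\<bar>w\<bar> \<le> 2" for r w :: real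
    using mult_left_mono[OF that, of "\<bar>r\<bar>"] by (simp add: abs_mult[symmetric])
  have "x1 * y2 - x2 * y1 \<le> 2 * (\<bar>x1\<bar> + \<bar>x2\<bar>)"
    using bound[OF y(2), of x1] bound[OF y(1), of "- x2"] by simp
  moreover have "x1 * y2 - x2 * y1 \<le> 2 * (\<bar>x1 - x2\<bar> + \<bar>x2\<bar>)"
    using bound[OF y(2), of "x1 - x2"] bound[OF y(3), of "- x2"] by (simp add: algebra_simps)
  moreover have "x1 * y2 - x2 * y1 \<le> 2 * (\<bar>x1 - x2\<bar> + \<bar>x1\<bar>)"
    using bound[OF y(1), of "x1 - x2"] bound[OF y(3), of "- x1"] by (simp add: algebra_simps)
  ultimately show ?thesis using assms(1-3) by (smt (verit))
qed

lemma extremal_hexagon: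
  defines "H \<equiv> convex hull (set hexagon_vertices)"
  shows "convex_ngon 6 H" "max_area_ratio 4 H = 2 / 3"
proof -
  have "distinct hexagon_vertices" by (simp add: hexagon_vertices_def vec_eq_iff forall_2)
  then have card: "card (set hexagon_vertices) = 6"
    by (simp only: distinct_card) (simp add: hexagon_vertices_def)
  show ngon: "convex_ngon 6 H"
    using ngon_hull[OF _ hexagon_vertices_independent] card unfolding H_def by simp
  have area: "measure lborel H = 3"
    using ccw_fan_area[OF hexagon_vertices_ccw[unfolded hexagon_vertices_def]]
    unfolding H_def hexagon_vertices_def by (simp add: orient_coords)
  have V: "{v. v extreme_point_of H} \<subseteq> set hexagon_vertices"
    unfolding H_def using extreme_point_of_convex_hull by blast
  have coords: "\<bar>(v - w) $ 1\<bar> \<le> 2" "\<bar>(v - w) $ 2\<bar> \<le> 2" "\<bar>(v - w) $ 1 - (v - w) $ 2\<bar> \<le> 2"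
    if "v \<in> set hexagon_vertices" "w \<in> set hexagon_vertices" for v w
    using that by (auto simp: hexagon_vertices_def)
  have quad4: "quad a b c d \<le> 4"
    if "a \<in> set hexagon_vertices" "b \<in> set hexagon_vertices" "c \<in> set hexagon_vertices"
      "d \<in> set hexagon_vertices" for a b c d
    using that unfolding quad_def cross_def by (intro hexagonal_norm_cross_le coords)
  let ?V = "{v. v extreme_point_of H}"
  have "max_area_ratio 4 H =
      Max ((\<lambda>(p, q, r, s). quad p q r s) ` (?V \<times> ?V \<times> ?V \<times> ?V)) / 2 / measure lborel H"
    by (rule max_area_ratio_eq[OF ngon]) simp
  moreover have "Max ((\<lambda>(p, q, r, s). quad p q r s) ` (?V \<times> ?V \<times> ?V \<times> ?V)) \<le> 4"
  proof (rule Max.boundedI)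
    show "finite ((\<lambda>(p, q, r, s). quad p q r s) ` (?V \<times> ?V \<times> ?V \<times> ?V))"
      using ngon_vertices(1)[OF ngon] by simp
    have "?V \<noteq> {}" using ngon_vertices(2)[OF ngon] by (metis card.empty zero_neq_numeral)
    then show "(\<lambda>(p, q, r, s). quad p q r s) ` (?V \<times> ?V \<times> ?V \<times> ?V) \<noteq> {}" by blast
    show "r \<le> 4" if "r \<in> (\<lambda>(p, q, r, s). quad p q r s) ` (?V \<times> ?V \<times> ?V \<times> ?V)" for r
      using that quad4 subsetD[OF V] by auto
  qed
  ultimately have "max_area_ratio 4 H \<le> 2 / 3" by (simp add: area)
  then show "max_area_ratio 4 H = 2 / 3" using hexagon_ratio_ge[OF ngon] by simp
qed

theorem theorem3p2:
  "minmax_area_ratio 6 4 = 2 / 3"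
  unfolding minmax_area_ratio_def
proof (rule Least_equality)
  show "\<exists>P. convex_ngon 6 P \<and> 2 / 3 = max_area_ratio 4 P"
    using extremal_hexagon by metis
  show "2 / 3 \<le> r" if "\<exists>P. convex_ngon 6 P \<and> r = max_area_ratio 4 P" for r
    using that hexagon_ratio_ge by blast
qed

end
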